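(* Let $\theta_1=\phi_1(D)$ and $\theta_2=\phi_2(D)$ be delta operators with poweroids $x^{\{n\}_1}$ and $x^{\{n\}_2}$, and let the connection constants $(m;2\mid n;1)$ be defined by $$x^{\{n\}_1}=\sum_m (m;2\mid n;1)\;x^{\{m\}_2}.$$ Then the polynomials $\sum_m (m;2\mid n;1)\,x^m$, $n=0,1,2,\dots$, are the poweroids $x^{\{n\}_3}$ of the delta operator $\theta_3=\phi_3(D)$ with $\phi_3=\phi_1\circ\phi_2^{-1}$ (so that $\phi_1=\phi_3\circ\phi_2$). In other words, $(m;2\mid n;1)$ is the coefficient of $x^m$ in the poweroid $x^{\{n\}_3}$.
   Context: Work with polynomials in $x$ (real or complex coefficients); $D=d/dx$. A delta operator is $\theta=\phi(D)$, where $\phi(t)=\sum_{\nu\ge1}k_\nu t^\nu$ is a formal power series with $k_1=1$; $\phi^{-1}$ is its compositional inverse. The poweroids $x^{\{n\}}$ of $\theta$ are the unique polynomials with $x^{\{0\}}=1$, $\theta x^{\{n\}}=n\,x^{\{n-1\}}$ for $n\ge1$, and $x^{\{n\}}|_{x=0}=0$ for $n\ge1$; $x^{\{n\}}$ has degree $n$. The subscripts $1,2,3$ on $\{n\}$ indicate the delta operator. *)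

theory Defs
  imports
    "HOL-Computational_Algebra.Polynomial"
    "HOL-Computational_Algebra.Formal_Power_Series"
begin

text \<open>
  The operator \<open>\<phi>(D) = (\<Sum>\<nu>. k\<^sub>\<nu> D\<^sup>\<nu>)\<close> on polynomials. Since \<open>D\<^sup>\<nu> p = 0\<close> for \<open>\<nu> > degree p\<close>,
  the series may be cut off there; see \<open>series_op_eq\<close> below.
\<close>

definition series_op :: "'a::field_char_0 fps \<Rightarrow> 'a poly \<Rightarrow> 'a poly" where
  "series_op \<phi> p = (\<Sum>\<nu>\<le>degree p. smult (fps_nth \<phi> \<nu>) ((pderiv ^^ \<nu>) p))"

definition delta_series :: "'a::field_char_0 fps \<Rightarrow> bool" where
  "delta_series \<phi> \<longleftrightarrow> fps_nth \<phi> 0 = 0 \<and> fps_nth \<phi> 1 = 1"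

definition poweroids :: "'a::field_char_0 fps \<Rightarrow> (nat \<Rightarrow> 'a poly) \<Rightarrow> bool" where
  "poweroids \<phi> X \<longleftrightarrow>
     X 0 = 1 \<and>
     (\<forall>n\<ge>1. series_op \<phi> (X n) = smult (of_nat n) (X (n - 1))) \<and>
     (\<forall>n\<ge>1. poly (X n) 0 = 0)"

text \<open>
  \<open>c m n\<close> plays the role of \<open>(m;2|n;1)\<close>, the coefficient of \<open>X2 m\<close> in the expansion of \<open>X1 n\<close>.
  Only finiteness of the expansion is required, not \<open>c m n = 0\<close> for \<open>m > n\<close>.
\<close>

definition connection_constants ::
    "(nat \<Rightarrow> 'a::field_char_0 poly) \<Rightarrow> (nat \<Rightarrow> 'a poly) \<Rightarrow> (nat \<Rightarrow> nat \<Rightarrow> 'a) \<Rightarrow> bool" where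
  "connection_constants X2 X1 c \<longleftrightarrow>
     (\<forall>n. finite {m. c m n \<noteq> 0} \<and> X1 n = (\<Sum>m | c m n \<noteq> 0. smult (c m n) (X2 m)))"


text \<open>The notions above are well defined: poweroids and connection constants exist uniquely.\<close>

lemma series_op_eq:
  assumes "degree p \<le> N"
  shows "series_op \<phi> p = (\<Sum>\<nu>\<le>N. smult (fps_nth \<phi> \<nu>) ((pderiv ^^ \<nu>) p))"
  unfolding series_op_def
proof (rule sum.mono_neutral_left)
  have "coeff ((pderiv ^^ \<nu>) p) i = 0" if "\<nu> > degree p" for \<nu> i
    using that by (simp add: coeff_higher_pderiv coeff_eq_0)
  thus "\<forall>\<nu>\<in>{..N} - {..degree p}. smult (fps_nth \<phi> \<nu>) ((pderiv ^^ \<nu>) p) = 0"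
    by (auto simp: poly_eq_iff)
qed (use assms in auto)

lemma series_op_add: "series_op \<phi> (p + q) = series_op \<phi> p + series_op \<phi> q"
proof -
  define N where "N = max (degree p) (degree q)"
  have "degree p \<le> N" "degree q \<le> N" "degree (p + q) \<le> N"
    unfolding N_def by (auto intro: degree_add_le)
  thus ?thesis
    by (simp add: series_op_eq[of _ N] higher_pderiv_add smult_add_right sum.distrib)
qed

lemma series_op_minus: "series_op \<phi> (p - q) = series_op \<phi> p - series_op \<phi> q"
  using series_op_add[of \<phi> "p - q" q] by simp

lemma degree_series_op_le:
  assumes "delta_series \<phi>" "degree p \<le> Suc d"
  shows "degree (series_op \<phi> p) \<le> d"
    and "coeff (series_op \<phi> p) d = of_nat (Suc d) * coeff p (Suc d)"
proof -
  have *: "series_op \<phi> p =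
      pderiv p + (\<Sum>\<nu>\<in>{2..Suc d}. smult (fps_nth \<phi> \<nu>) ((pderiv ^^ \<nu>) p))"
  proof -
    have "{..Suc d} = insert 0 (insert 1 {2..Suc d})" by auto
    thus ?thesis using assms by (simp add: series_op_eq[of p "Suc d"] delta_series_def)
  qed
  have **: "coeff (smult (fps_nth \<phi> \<nu>) ((pderiv ^^ \<nu>) p)) i = 0" if "\<nu> \<ge> 2" "i \<ge> d" for \<nu> i
    using that assms(2) by (simp add: coeff_higher_pderiv coeff_eq_0)
  have "coeff (\<Sum>\<nu>\<in>{2..Suc d}. smult (fps_nth \<phi> \<nu>) ((pderiv ^^ \<nu>) p)) i = 0" if "i \<ge> d" for i
    unfolding coeff_sum by (rule sum.neutral) (use that ** in auto)
  hence ***: "coeff (series_op \<phi> p) i = of_nat (Suc i) * coeff p (Suc i)" if "i \<ge> d" for i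
    using that unfolding * coeff_add coeff_pderiv by simp
  show "degree (series_op \<phi> p) \<le> d"
  proof (intro degree_le allI impI)
    fix i assume "i > d"
    thus "coeff (series_op \<phi> p) i = 0" using ***[of i] assms(2) by (simp add: coeff_eq_0)
  qed
  show "coeff (series_op \<phi> p) d = of_nat (Suc d) * coeff p (Suc d)"
    using ***[of d] by simp
qed

lemma series_op_kernel:
  assumes "delta_series \<phi>" "series_op \<phi> p = 0" "poly p 0 = 0"
  shows "p = 0"
proof (cases "degree p")
  case 0
  with assms(3) show ?thesis by (auto elim: degree_eq_zeroE)
next
  case (Suc d)
  have "of_nat (Suc d) * coeff p (Suc d) = 0"
    using degree_series_op_le(2)[OF assms(1), of p d] Suc assms(2) by simp
  hence "lead_coeff p = 0" using Suc by (simp del: of_nat_Suc)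
  thus ?thesis by simp
qed

lemma series_op_surj:
  assumes "delta_series \<phi>"
  shows "\<exists>p. series_op \<phi> p = q \<and> poly p 0 = 0"
proof (induction "if q = 0 then 0 else Suc (degree q)" arbitrary: q rule: less_induct)
  case less
  show ?case
  proof (cases "q = 0")
    case True
    thus ?thesis by (intro exI[of _ 0]) (simp add: series_op_def)
  next
    case False
    define d where "d = degree q"
    define p0 where "p0 = monom (coeff q d / of_nat (Suc d)) (Suc d)"
    have d0: "degree p0 \<le> Suc d" unfolding p0_def by (rule degree_monom_le)
    define r where "r = q - series_op \<phi> p0"
    have c: "coeff r d = 0"
      using degree_series_op_le(2)[OF assms d0] unfolding r_def
      by (simp add: p0_def del: of_nat_Suc)
    have dr: "degree r \<le> d"
      unfolding r_def d_def
      by (intro degree_diff_le) (use degree_series_op_le(1)[OF assms d0] d_def in auto)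
    have "r = 0 \<or> degree r < d"
      using c dr by (metis leading_coeff_0_iff le_neq_implies_less)
    hence "(if r = 0 then 0 else Suc (degree r)) < (if q = 0 then 0 else Suc (degree q))"
      using False by (auto simp: d_def)
    from less[OF this] obtain p where p: "series_op \<phi> p = r" "poly p 0 = 0" by blast
    have "series_op \<phi> (p0 + p) = q" "poly (p0 + p) 0 = 0"
      using p by (simp_all add: series_op_add r_def) (simp add: p0_def poly_monom)
    thus ?thesis by blast
  qed
qed

lemma poweroids_Suc:
  assumes "poweroids \<phi> X"
  shows "series_op \<phi> (X (Suc n)) = smult (of_nat (Suc n)) (X n)" "poly (X (Suc n)) 0 = 0"
  using assms by (simp_all add: poweroids_def del: of_nat_Suc)

lemma poweroids_ex1:
  assumes "delta_series \<phi>"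
  shows "\<exists>!X. poweroids \<phi> X"
proof (rule ex_ex1I)
  define s where "s n q = (SOME p. series_op \<phi> p = smult (of_nat (Suc n)) q \<and> poly p 0 = 0)" for n q
  define X where "X = rec_nat 1 s"
  have "series_op \<phi> (s n q) = smult (of_nat (Suc n)) q \<and> poly (s n q) 0 = 0" for n q
    unfolding s_def using series_op_surj[OF assms] by (rule someI_ex)
  moreover have "X 0 = 1" "X (Suc n) = s n (X n)" for n by (simp_all add: X_def)
  ultimately have "series_op \<phi> (X n) = smult (of_nat n) (X (n - 1)) \<and> poly (X n) 0 = 0"
    if "n \<ge> 1" for n
    using that by (cases n) auto
  with \<open>X 0 = 1\<close> have "poweroids \<phi> X" unfolding poweroids_def by blast
  thus "\<exists>X. poweroids \<phi> X" by blast
next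
  fix X Y assume X: "poweroids \<phi> X" and Y: "poweroids \<phi> Y"
  have "X n = Y n" for n
  proof (induction n)
    case 0
    show ?case using X Y by (simp add: poweroids_def)
  next
    case (Suc n)
    have "X (Suc n) - Y (Suc n) = 0"
    proof (rule series_op_kernel[OF assms])
      show "series_op \<phi> (X (Suc n) - Y (Suc n)) = 0"
        unfolding series_op_minus poweroids_Suc[OF X] poweroids_Suc[OF Y] Suc by simp
      show "poly (X (Suc n) - Y (Suc n)) 0 = 0"
        by (simp add: poweroids_Suc[OF X] poweroids_Suc[OF Y])
    qed
    thus ?case by simp
  qed
  thus "X = Y" ..
qed

lemma degree_poweroids:
  assumes "delta_series \<phi>" "poweroids \<phi> X"
  shows "degree (X n) = n \<and> X n \<noteq> 0"
proof (induction n)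
  case 0
  show ?case using assms(2) by (simp add: poweroids_def)
next
  case (Suc n)
  have eq: "series_op \<phi> (X (Suc n)) = smult (of_nat (Suc n)) (X n)"
    and z: "poly (X (Suc n)) 0 = 0"
    using poweroids_Suc[OF assms(2)] by blast+
  have nz: "series_op \<phi> (X (Suc n)) \<noteq> 0"
    using Suc by (simp add: eq del: of_nat_Suc)
  hence X0: "X (Suc n) \<noteq> 0" by (auto simp: series_op_def)
  have "degree (X (Suc n)) \<noteq> 0"
  proof
    assume "degree (X (Suc n)) = 0"
    thus False using z X0 by (auto elim: degree_eq_zeroE)
  qed
  then obtain d where d: "degree (X (Suc n)) = Suc d"
    using not0_implies_Suc by blast
  have "degree (series_op \<phi> (X (Suc n))) = d"
  proof (rule antisym)
    show "degree (series_op \<phi> (X (Suc n))) \<le> d"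
      using degree_series_op_le(1)[OF assms(1)] d by simp
    have "coeff (X (Suc n)) (Suc d) \<noteq> 0"
      using X0 d leading_coeff_0_iff[of "X (Suc n)"] by simp
    hence "coeff (series_op \<phi> (X (Suc n))) d \<noteq> 0"
      using degree_series_op_le(2)[OF assms(1), of "X (Suc n)" d] d by (simp del: of_nat_Suc)
    thus "d \<le> degree (series_op \<phi> (X (Suc n)))" by (rule le_degree)
  qed
  hence "d = n" using Suc by (simp add: eq del: of_nat_Suc)
  thus ?case using d X0 by simp
qed

lemma expansion_ex:
  fixes X :: "nat \<Rightarrow> 'a::field_char_0 poly"
  assumes "\<And>n. degree (X n) = n \<and> X n \<noteq> 0" "degree p < N"
  shows "\<exists>c. (\<forall>m\<ge>N. c m = 0) \<and> p = (\<Sum>m<N. smult (c m) (X m))"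
  using assms(2)
proof (induction N arbitrary: p)
  case (Suc N)
  define a where "a = coeff p N / lead_coeff (X N)"
  define r where "r = p - smult a (X N)"
  have X: "degree (X N) = N" "coeff (X N) N \<noteq> 0"
    using assms(1)[of N] leading_coeff_0_iff[of "X N"] by auto
  have "coeff r i = 0" if "i \<ge> N" for i
    using that X Suc.prems
    by (cases "i = N") (auto simp: r_def a_def coeff_eq_0)
  hence r: "r = 0 \<or> degree r < N" by (metis leading_coeff_0_iff not_le)
  have "\<exists>c. (\<forall>m\<ge>N. c m = 0) \<and> r = (\<Sum>m<N. smult (c m) (X m))"
  proof (cases "r = 0")
    case True
    thus ?thesis by (intro exI[of _ "\<lambda>_. 0"]) simp
  qed (use r Suc.IH in blast)
  then obtain c where c: "\<forall>m\<ge>N. c m = 0" "r = (\<Sum>m<N. smult (c m) (X m))" by blast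
  have "p = (\<Sum>m<Suc N. smult ((c(N := a)) m) (X m))"
    using c(2) by (simp add: r_def algebra_simps)
  moreover have "\<forall>m\<ge>Suc N. (c(N := a)) m = 0" using c(1) by simp
  ultimately show ?case by blast
qed simp

lemma expansion_unique:
  fixes X :: "nat \<Rightarrow> 'a::field_char_0 poly"
  assumes "\<And>n. degree (X n) = n \<and> X n \<noteq> 0" "(\<Sum>m<N. smult (c m) (X m)) = 0" "k < N"
  shows "c k = 0"
  using assms(2,3)
proof (induction N)
  case (Suc N)
  have X: "coeff (X N) N \<noteq> 0"
    using assms(1)[of N] leading_coeff_0_iff[of "X N"] by auto
  have "coeff (\<Sum>m<Suc N. smult (c m) (X m)) N = c N * coeff (X N) N"
    using assms(1) by (simp add: coeff_sum coeff_eq_0)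
  hence "c N = 0" using X unfolding Suc.prems(1) by simp
  thus ?case using Suc by (cases "k = N") auto
qed simp

lemma connection_constants_ex1:
  assumes "delta_series \<phi>" "poweroids \<phi> X2"
  shows "\<exists>!c. connection_constants X2 X1 c"
proof (rule ex_ex1I)
  note deg = degree_poweroids[OF assms]
  have "\<exists>c. (\<forall>m\<ge>Suc (degree (X1 n)). c m = 0) \<and>
      X1 n = (\<Sum>m<Suc (degree (X1 n)). smult (c m) (X2 m))" for n
    by (rule expansion_ex[OF deg]) simp
  then obtain c where c: "\<And>n m. m \<ge> Suc (degree (X1 n)) \<Longrightarrow> c n m = 0"
      "\<And>n. X1 n = (\<Sum>m<Suc (degree (X1 n)). smult (c n m) (X2 m))"
    by metis
  have sub: "{m. c n m \<noteq> 0} \<subseteq> {..<Suc (degree (X1 n))}" for n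
    using c(1) by (force simp: not_le[symmetric])
  have "(\<Sum>m | c n m \<noteq> 0. smult (c n m) (X2 m)) = X1 n" for n
    by (rule trans[OF sum.mono_neutral_left c(2)[symmetric]]) (use sub in auto)
  hence "connection_constants X2 X1 (\<lambda>m n. c n m)"
    unfolding connection_constants_def using finite_subset[OF sub] by simp
  thus "\<exists>c. connection_constants X2 X1 c" by blast
next
  note deg = degree_poweroids[OF assms]
  fix c c' assume c: "connection_constants X2 X1 c" and c': "connection_constants X2 X1 c'"
  have "c k n = c' k n" for k n
  proof -
    have fin: "finite ({m. c m n \<noteq> 0} \<union> {m. c' m n \<noteq> 0} \<union> {k})"
      using c c' by (simp add: connection_constants_def)
    then obtain N where N: "{m. c m n \<noteq> 0} \<union> {m. c' m n \<noteq> 0} \<union> {k} \<subseteq> {..<N}"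
      using finite_nat_iff_bounded by blast
    have "X1 n = (\<Sum>m | c m n \<noteq> 0. smult (c m n) (X2 m))"
      using c by (simp add: connection_constants_def)
    also have "\<dots> = (\<Sum>m<N. smult (c m n) (X2 m))"
      by (rule sum.mono_neutral_left) (use N in auto)
    finally have 1: "X1 n = \<dots>" .
    have "X1 n = (\<Sum>m | c' m n \<noteq> 0. smult (c' m n) (X2 m))"
      using c' by (simp add: connection_constants_def)
    also have "\<dots> = (\<Sum>m<N. smult (c' m n) (X2 m))"
      by (rule sum.mono_neutral_left) (use N in auto)
    finally have "(\<Sum>m<N. smult (c m n - c' m n) (X2 m)) = 0"
      using 1 by (simp add: smult_diff_left sum_subtractf)
    from expansion_unique[OF deg this, of k] show ?thesis using N by simp
  qed
  thus "c = c'" by (intro ext)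
qed

end

(*
  The linear map U sending x^m to the m-th poweroid of phi2 satisfies phi2(D) U = U D, hence
  (phi o phi2)(D) U = U phi(D) for every power series phi.  By definition of the connection
  constants U maps P n = sum_m (m;2|n;1) x^m to the n-th poweroid of phi1 = phi3 o phi2, so
  applying phi1(D) gives U (phi3(D) (P n)) = U (n P (n-1)); and U is injective and preserves
  the value at 0.
*)
theory Submission
  imports Defs
begin

section \<open>Power series in the derivative\<close>

lemma smult_sum_right: "smult a (\<Sum>i\<in>A. f i) = (\<Sum>i\<in>A. smult a (f i))"
  by (induction A rule: infinite_finite_induct) (simp_all add: smult_add_right)

lemma degree_higher_pderiv_le: "degree ((pderiv ^^ n) p) \<le> degree p"
  for p :: "'a::field_char_0 poly"
proof (induction n)
  case (Suc n)
  then show ?case by (simp add: degree_pderiv)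
qed simp

lemma higher_pderiv_eq_0: "degree p < n \<Longrightarrow> (pderiv ^^ n) p = 0"
  for p :: "'a::field_char_0 poly"
  by (simp add: poly_eq_iff coeff_higher_pderiv coeff_eq_0)

lemma higher_pderiv_sum: "(pderiv ^^ n) (\<Sum>i\<in>A. f i) = (\<Sum>i\<in>A. (pderiv ^^ n) (f i))"
  for f :: "'b \<Rightarrow> 'a::field_char_0 poly"
  by (induction A rule: infinite_finite_induct) (simp_all add: higher_pderiv_add)

lemma series_op_smult: "series_op \<phi> (smult a p) = smult a (series_op \<phi> p)"
proof (cases "a = 0")
  case False
  then show ?thesis
    by (simp add: series_op_def higher_pderiv_smult smult_sum_right mult.commute)
qed (simp add: series_op_def)

lemma series_op_sum: "series_op \<phi> (\<Sum>i\<in>A. f i) = (\<Sum>i\<in>A. series_op \<phi> (f i))"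
  by (induction A rule: infinite_finite_induct) (simp_all add: series_op_add, simp_all add: series_op_def)

lemma series_op_1: "series_op 1 p = p"
proof -
  have "series_op 1 p = (\<Sum>\<nu>\<le>degree p. if \<nu> = 0 then (pderiv ^^ \<nu>) p else 0)"
    unfolding series_op_def by (rule sum.cong) auto
  then show ?thesis by simp
qed

text \<open>Both sides are the sum of \<open>g i j\<close> over \<open>i + j \<le> N\<close>. On the
  composition side it arises from a square of indices, where the terms with \<open>i + j > N\<close>
  vanish because the derivative exceeds the degree; summed along its diagonals, the remaining
  triangle is the Cauchy product.\<close>

lemma series_op_mult: "series_op (a * b) p = series_op a (series_op b p)"
proof -
  define N where "N = degree p"
  define g where "g i j = smult (fps_nth a i * fps_nth b j) ((pderiv ^^ (i + j)) p)" for i j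
  \<comment> \<open>This lets the outer operator be cut off at the same \<open>N\<close> as the
    inner one.\<close>
  have dN: "degree (series_op b p) \<le> N"
    unfolding series_op_def N_def
    by (intro degree_sum_le) (auto intro: order.trans[OF degree_smult_le] degree_higher_pderiv_le)
  have "series_op a (series_op b p) = (\<Sum>i\<le>N. \<Sum>j\<le>N. g i j)"
    unfolding series_op_eq[OF dN] unfolding series_op_def N_def[symmetric] g_def
    by (simp add: higher_pderiv_sum higher_pderiv_smult smult_sum_right funpow_add)
  also have "\<dots> = (\<Sum>(i,j)\<in>{..N} \<times> {..N}. g i j)"
    by (simp add: sum.cartesian_product)
  also have "\<dots> = (\<Sum>(i,j)\<in>{(i,j). i + j \<le> N}. g i j)"
    by (rule sum.mono_neutral_right) (auto simp: g_def N_def higher_pderiv_eq_0 simp flip: not_less)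
  also have "\<dots> = (\<Sum>k\<le>N. \<Sum>i\<le>k. g i (k - i))"
    by (rule sum.triangle_reindex_eq)
  also have "\<dots> = series_op (a * b) p"
    by (simp add: series_op_def N_def g_def fps_mult_nth smult_sum atLeast0AtMost)
  finally show ?thesis ..
qed

lemma series_op_power: "series_op (a ^ n) p = (series_op a ^^ n) p"
  by (induction n arbitrary: p) (simp_all add: series_op_1 series_op_mult)

text \<open>The power \<open>\<psi> ^ i\<close> has no terms below order \<open>i\<close>, so each
  inner sum can be extended from \<open>i \<le> \<nu>\<close> to \<open>i \<le> N\<close>. The two
  finite sums can then be interchanged.\<close>

lemma series_op_compose:
  assumes "fps_nth \<psi> 0 = 0" "degree p \<le> N"
  shows "series_op (\<phi> oo \<psi>) p = (\<Sum>i\<le>N. smult (fps_nth \<phi> i) ((series_op \<psi> ^^ i) p))"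
proof -
  have "series_op (\<phi> oo \<psi>) p
      = (\<Sum>\<nu>\<le>N. \<Sum>i\<le>\<nu>. smult (fps_nth \<phi> i * fps_nth (\<psi> ^ i) \<nu>) ((pderiv ^^ \<nu>) p))"
    by (simp add: series_op_eq[OF assms(2)] fps_compose_nth smult_sum atLeast0AtMost)
  also have "\<dots> = (\<Sum>\<nu>\<le>N. \<Sum>i\<le>N. smult (fps_nth \<phi> i * fps_nth (\<psi> ^ i) \<nu>) ((pderiv ^^ \<nu>) p))"
    by (intro sum.cong[OF refl] sum.mono_neutral_left)
      (auto simp: startsby_zero_power_prefix[OF assms(1)])
  also have "\<dots> = (\<Sum>i\<le>N. smult (fps_nth \<phi> i) (series_op (\<psi> ^ i) p))"
    by (subst sum.swap) (simp add: series_op_eq[OF assms(2)] smult_sum_right)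
  finally show ?thesis by (simp add: series_op_power)
qed

section \<open>The umbral map of a sequence of polynomials\<close>

text \<open>The map U of the overview, for an arbitrary sequence \<open>X\<close>.\<close>

definition umbral :: "(nat \<Rightarrow> 'a::field_char_0 poly) \<Rightarrow> 'a poly \<Rightarrow> 'a poly" where
  "umbral X p = (\<Sum>m\<le>degree p. smult (coeff p m) (X m))"

lemma umbral_eq:
  assumes "degree p \<le> N"
  shows "umbral X p = (\<Sum>m\<le>N. smult (coeff p m) (X m))"
  unfolding umbral_def
  by (rule sum.mono_neutral_left) (use assms in \<open>auto simp: coeff_eq_0\<close>)

lemma umbral_add: "umbral X (p + q) = umbral X p + umbral X q"
proof -
  define N where "N = max (degree p) (degree q)"
  have "degree p \<le> N" "degree q \<le> N" "degree (p + q) \<le> N"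
    unfolding N_def by (auto intro: degree_add_le)
  then show ?thesis
    by (simp add: umbral_eq[of _ N] smult_add_left sum.distrib)
qed

lemma umbral_diff: "umbral X (p - q) = umbral X p - umbral X q"
  using umbral_add[of X "p - q" q] by simp

lemma umbral_smult: "umbral X (smult a p) = smult a (umbral X p)"
  by (subst umbral_eq[of _ "degree p"]) (simp_all add: umbral_def smult_sum_right)

lemma umbral_sum: "umbral X (\<Sum>i\<in>A. f i) = (\<Sum>i\<in>A. umbral X (f i))"
  by (induction A rule: infinite_finite_induct) (simp_all add: umbral_add, simp_all add: umbral_def)

lemma umbral_monom: "umbral X (monom a n) = smult a (X n)"
proof -
  have "umbral X (monom a n) = (\<Sum>m\<le>n. if m = n then smult a (X m) else 0)"
    unfolding umbral_eq[OF degree_monom_le] by (rule sum.cong) auto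
  then show ?thesis by simp
qed

lemma umbral_inject:
  assumes "\<And>n. degree (X n) = n \<and> X n \<noteq> 0"
  shows "umbral X p = umbral X q \<longleftrightarrow> p = q"
proof
  assume "umbral X p = umbral X q"
  then have "(\<Sum>m<Suc (degree (p - q)). smult (coeff (p - q) m) (X m)) = 0"
    using umbral_diff[of X p q] unfolding umbral_def lessThan_Suc_atMost by simp
  \<comment> \<open>The top index suffices: only the zero polynomial has leading coefficient
    0.\<close>
  from expansion_unique[OF assms this, of "degree (p - q)"]
  have "lead_coeff (p - q) = 0" by simp
  then show "p = q" by (simp only: leading_coeff_0_iff right_minus_eq)
qed simp

lemma poly_umbral_poweroids_0:
  assumes "poweroids \<phi> X"
  shows "poly (umbral X p) 0 = coeff p 0"
proof -
  have "poly (X m) 0 = (if m = 0 then 1 else 0)" for m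
    using assms by (auto simp: poweroids_def)
  then have "poly (umbral X p) 0 = (\<Sum>m\<le>degree p. if m = 0 then coeff p m else 0)"
    unfolding umbral_def poly_sum by (intro sum.cong) auto
  then show ?thesis by simp
qed

text \<open>On the basis this is the defining recurrence of poweroids: both sides send x^m to m
  times \<open>X (m - 1)\<close>, and constants to 0.\<close>

lemma umbral_pderiv:
  assumes "delta_series \<phi>" "poweroids \<phi> X"
  shows "umbral X (pderiv p) = series_op \<phi> (umbral X p)"
proof -
  define N where "N = degree p"
  have "series_op \<phi> 1 = 0"
    using assms(1) by (simp add: series_op_def delta_series_def)
  then have 0: "series_op \<phi> (X 0) = 0"
    using assms(2) by (simp add: poweroids_def)
  \<comment> \<open>The bound \<open>Suc N\<close> leaves indices up to \<open>N\<close> once the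
    term \<open>m = 0\<close>, which the operator kills, is split off.\<close>
  have "umbral X p = (\<Sum>m\<le>Suc N. smult (coeff p m) (X m))"
    by (rule umbral_eq) (simp add: N_def)
  then have "series_op \<phi> (umbral X p) = (\<Sum>m\<le>Suc N. smult (coeff p m) (series_op \<phi> (X m)))"
    by (simp only: series_op_sum series_op_smult)
  also have "\<dots> = (\<Sum>m\<le>N. smult (coeff (pderiv p) m) (X m))"
    by (simp only: sum.atMost_Suc_shift 0 poweroids_Suc(1)[OF assms(2)] coeff_pderiv)
      (simp add: mult.commute)
  also have "\<dots> = umbral X (pderiv p)"
    by (rule umbral_eq[symmetric]) (simp add: N_def degree_pderiv)
  finally show ?thesis ..
qed

text \<open>Iterating \<open>umbral_pderiv\<close> carries the k-th derivative to the k-th iterate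
  of \<open>series_op \<psi>\<close>; weighting by the coefficients of \<open>\<phi>\<close> and
  summing gives the composed series.\<close>

lemma umbral_series_op:
  assumes "delta_series \<psi>" "poweroids \<psi> X"
  shows "umbral X (series_op \<phi> p) = series_op (\<phi> oo \<psi>) (umbral X p)"
proof -
  have iter: "umbral X ((pderiv ^^ k) p) = (series_op \<psi> ^^ k) (umbral X p)" for k
    by (induction k) (simp_all add: umbral_pderiv[OF assms])
  \<comment> \<open>Since U does not raise degrees, both series may be cut off at
    \<open>degree p\<close>.\<close>
  have "degree (umbral X p) \<le> degree p"
    unfolding umbral_def
    by (intro degree_sum_le)
      (auto intro: order.trans[OF degree_smult_le] simp: degree_poweroids[OF assms])
  moreover have "fps_nth \<psi> 0 = 0"
    using assms(1) by (simp add: delta_series_def)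
  ultimately have "series_op (\<phi> oo \<psi>) (umbral X p)
      = (\<Sum>i\<le>degree p. smult (fps_nth \<phi> i) ((series_op \<psi> ^^ i) (umbral X p)))"
    by (intro series_op_compose)
  then show ?thesis
    by (simp add: series_op_def[of \<phi> p] umbral_sum umbral_smult iter)
qed

section \<open>Connection constants\<close>

lemma delta_series_compose_inv:
  assumes "delta_series \<phi>" "delta_series \<psi>"
  shows "delta_series (\<phi> oo fps_inv \<psi>)"
  using assms by (simp add: delta_series_def fps_compose_nth fps_inv_def)

lemma fps_compose_inv_cancel:
  assumes "delta_series \<psi>"
  shows "(\<phi> oo fps_inv \<psi>) oo \<psi> = \<phi>"
proof -
  have \<psi>: "fps_nth \<psi> 0 = 0" "fps_nth \<psi> 1 \<noteq> 0"
    using assms by (simp_all add: delta_series_def)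
  moreover have "fps_nth (fps_inv \<psi>) 0 = 0" by (simp add: fps_inv_def)
  ultimately show ?thesis
    by (simp add: fps_compose_assoc[symmetric] fps_inv)
qed

theorem mainTheorem7:
  fixes \<phi>1 \<phi>2 \<phi>3 :: "'a::field_char_0 fps"
    and X1 X2 :: "nat \<Rightarrow> 'a poly"
    and c :: "nat \<Rightarrow> nat \<Rightarrow> 'a"
  assumes "delta_series \<phi>1" and "delta_series \<phi>2"
    and "poweroids \<phi>1 X1" and "poweroids \<phi>2 X2"
    and "connection_constants X2 X1 c"
    and "\<phi>3 = \<phi>1 oo fps_inv \<phi>2"
  shows "delta_series \<phi>3 \<and>
    \<phi>1 = \<phi>3 oo \<phi>2 \<and>
    poweroids \<phi>3 (\<lambda>n. \<Sum>m | c m n \<noteq> 0. monom (c m n) m) \<and>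
    (\<forall>X3. poweroids \<phi>3 X3 \<longrightarrow> (\<forall>m n. c m n = coeff (X3 n) m))"
proof -
  define P where "P n = (\<Sum>m | c m n \<noteq> 0. monom (c m n) m)" for n
  have delta: "delta_series \<phi>3" and comp: "\<phi>1 = \<phi>3 oo \<phi>2"
    using assms by (simp_all add: delta_series_compose_inv fps_compose_inv_cancel)
  note inj = umbral_inject[OF degree_poweroids[OF assms(2,4)]]
  have U: "umbral X2 (P n) = X1 n" for n
    using assms(5) by (simp add: P_def umbral_sum umbral_monom connection_constants_def)
  have "umbral X2 (P 0) = umbral X2 1"
    using umbral_monom[of X2 1 0] assms(3,4) by (simp add: U poweroids_def)
  then have "P 0 = 1" by (simp only: inj)
  moreover have "series_op \<phi>3 (P n) = smult (of_nat n) (P (n - 1))" if "n \<ge> 1" for n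
  proof -
    have "umbral X2 (series_op \<phi>3 (P n)) = umbral X2 (smult (of_nat n) (P (n - 1)))"
      using assms(3) that
      by (simp add: umbral_series_op[OF assms(2,4)] comp[symmetric] umbral_smult U poweroids_def)
    then show ?thesis by (simp only: inj)
  qed
  moreover have "poly (P n) 0 = 0" if "n \<ge> 1" for n
    \<comment> \<open>The constant term of \<open>P n\<close> equals the value at 0 of its image
      \<open>X1 n\<close>.\<close>
    using assms(3) that poly_umbral_poweroids_0[OF assms(4), of "P n"]
    by (simp add: U poweroids_def poly_0_coeff_0)
  ultimately have P: "poweroids \<phi>3 P" by (simp add: poweroids_def)
  have "coeff (P n) m = c m n" for m n
    using assms(5) by (auto simp: P_def coeff_sum connection_constants_def)
  \<comment> \<open>By uniqueness of poweroids, every such \<open>X3\<close> is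
    \<open>P\<close>.\<close>
  with P delta have "\<forall>X3. poweroids \<phi>3 X3 \<longrightarrow> (\<forall>m n. c m n = coeff (X3 n) m)"
    using poweroids_ex1 by metis
  with P delta comp show ?thesis unfolding P_def by blast
qed

end
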